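(* Let $c>0$ and $c_1=c_2=c$ (identical marginal costs), let $\alpha\in(0,1)$ and $\beta=\alpha/(1-\alpha)$. The equilibrium with positive prices of the Bertrand duopoly game described in the context is $p_1=p_2=\frac{c(2+\beta)}{\beta}$, with quantities $q_1=q_2=\frac{\beta}{2c(2+\beta)}$, profits $\Pi_1=\Pi_2=\frac{1}{2+\beta}=1+\frac{1}{\alpha-2}$, consumer surpluses $CS_1=CS_2=\frac{1}{\alpha}\ln 2$, and social welfare $W=\frac{2}{\alpha}\ln 2+\frac{2}{\alpha-2}+2$. Consequently, for $i=1,2$, $$\frac{\partial p_i}{\partial\alpha}=-\frac{2c}{\alpha^2}<0,\qquad \frac{\partial q_i}{\partial\alpha}=\frac{1}{(\alpha-2)^2c}>0,\qquad \frac{\partial \Pi_i}{\partial\alpha}=-\frac{1}{(\alpha-2)^2}<0,$$ and $$\frac{\partial W}{\partial\alpha}=-\frac{2\ln 2}{\alpha^2}-\frac{2}{(\alpha-2)^2}<0.$$ To summarize, in the special case of identical marginal costs, an increase in the substitutability degree $\alpha$ leads to a stable equilibrium with lower prices, higher supplies, lower profits, and lower welfare. In other words, the degree of product differentiation is positively related to the prices of the goods, the profits of the firms, and the social welfare.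
   Context: Two firms $i=1,2$ sell differentiated goods at prices $p_i>0$ with linear costs $c_iq_i$, $c_i>0$. The substitutability degree is $\alpha\in(0,1)$ (a decrease in $\alpha$ makes the products more differentiated), and $\beta=\alpha/(1-\alpha)$. Demands (from maximizing the utility $q_1^\alpha+q_2^\alpha$ subject to $p_1q_1+p_2q_2=1$) are $$q_1=\frac{p_2^\beta}{p_1}\cdot\frac{1}{p_1^\beta+p_2^\beta},\qquad q_2=\frac{p_1^\beta}{p_2}\cdot\frac{1}{p_1^\beta+p_2^\beta},$$ with inverse demands $p_1=\frac{q_1^{\alpha-1}}{q_1^\alpha+q_2^\alpha}$, $p_2=\frac{q_2^{\alpha-1}}{q_1^\alpha+q_2^\alpha}$. The profit of firm $i$ is $\Pi_i=(p_i-c_i)q_i$. The dynamics are $p_i(t+1)=p_i(t)+k_i\,\partial\Pi_i/\partial p_i$ with adjustment speeds $k_i>0$; an equilibrium is a fixed point of these dynamics, i.e. a pair with $$-\beta p_2^{\beta}p_1^{1+\beta}+\left(p_2^{2\beta}+(1+\beta)p_1^\beta p_2^\beta\right)c_1=0,\qquad -\beta p_1^{\beta}p_2^{1+\beta}+\left(p_1^{2\beta}+(1+\beta)p_1^\beta p_2^\beta\right)c_2=0.$$ Stability of an equilibrium refers to local stability under these dynamics. At a point $(q_1^*,q_2^* )$ the consumer surplus of the first product is $$CS_1=\int_0^{q_1^*}\frac{q_1^{\alpha-1}}{q_1^\alpha+(q_2^* )^\alpha}\,dq_1=\frac1\alpha\ln\left[1+\left(\frac{q_1^*}{q_2^*}\right)^\alpha\right],$$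 and $CS_2$ is defined symmetrically. Social welfare is $W=CS_1+CS_2+\Pi_1+\Pi_2$. In the derivatives, $p_i,q_i,\Pi_i,W$ are the equilibrium values viewed as functions of $\alpha$.
   Formalization: Stability of the equilibrium after an increase in α is asserted only for all sufficiently small adjustment speeds (bound depending on α and c), since for large speeds it is unstable; prices, supplies, profits and welfare are compared for all speeds. *)

theory Defs
  imports "HOL-Analysis.Analysis"
begin

definition beta :: "real \<Rightarrow> real" where
  "beta \<alpha> = \<alpha> / (1 - \<alpha>)"

definition demand1 :: "real \<Rightarrow> real \<Rightarrow> real \<Rightarrow> real" where
  "demand1 \<alpha> p1 p2 =
     (p2 powr beta \<alpha> / p1) * (1 / (p1 powr beta \<alpha> + p2 powr beta \<alpha>))"

definition demand2 :: "real \<Rightarrow> real \<Rightarrow> real \<Rightarrow> real" where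
  "demand2 \<alpha> p1 p2 =
     (p1 powr beta \<alpha> / p2) * (1 / (p1 powr beta \<alpha> + p2 powr beta \<alpha>))"

definition inverse_demand1 :: "real \<Rightarrow> real \<Rightarrow> real \<Rightarrow> real" where
  "inverse_demand1 \<alpha> q1 q2 = q1 powr (\<alpha> - 1) / (q1 powr \<alpha> + q2 powr \<alpha>)"

definition inverse_demand2 :: "real \<Rightarrow> real \<Rightarrow> real \<Rightarrow> real" where
  "inverse_demand2 \<alpha> q1 q2 = q2 powr (\<alpha> - 1) / (q1 powr \<alpha> + q2 powr \<alpha>)"

definition profit1 :: "real \<Rightarrow> real \<Rightarrow> real \<Rightarrow> real \<Rightarrow> real" where
  "profit1 \<alpha> c1 p1 p2 = (p1 - c1) * demand1 \<alpha> p1 p2"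

definition profit2 :: "real \<Rightarrow> real \<Rightarrow> real \<Rightarrow> real \<Rightarrow> real" where
  "profit2 \<alpha> c2 p1 p2 = (p2 - c2) * demand2 \<alpha> p1 p2"

(* The integrands are unbounded at 0 (exponent \<alpha> - 1 < 0) but integrable. *)
definition consumer_surplus1 :: "real \<Rightarrow> real \<Rightarrow> real \<Rightarrow> real" where
  "consumer_surplus1 \<alpha> q1 q2 = integral {0..q1} (\<lambda>x. inverse_demand1 \<alpha> x q2)"

definition consumer_surplus2 :: "real \<Rightarrow> real \<Rightarrow> real \<Rightarrow> real" where
  "consumer_surplus2 \<alpha> q1 q2 = integral {0..q2} (\<lambda>x. inverse_demand2 \<alpha> q1 x)"

definition welfare :: "real \<Rightarrow> real \<Rightarrow> real \<Rightarrow> real \<Rightarrow> real \<Rightarrow> real" where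
  "welfare \<alpha> c1 c2 p1 p2 =
     consumer_surplus1 \<alpha> (demand1 \<alpha> p1 p2) (demand2 \<alpha> p1 p2)
   + consumer_surplus2 \<alpha> (demand1 \<alpha> p1 p2) (demand2 \<alpha> p1 p2)
   + profit1 \<alpha> c1 p1 p2 + profit2 \<alpha> c2 p1 p2"

definition price_step ::
    "real \<Rightarrow> real \<Rightarrow> real \<Rightarrow> real \<Rightarrow> real \<Rightarrow> real \<times> real \<Rightarrow> real \<times> real" where
  "price_step \<alpha> c1 c2 k1 k2 = (\<lambda>(p1, p2).
     (p1 + k1 * deriv (\<lambda>x. profit1 \<alpha> c1 x p2) p1,
      p2 + k2 * deriv (\<lambda>x. profit2 \<alpha> c2 p1 x) p2))"

definition positive_equilibrium ::
    "real \<Rightarrow> real \<Rightarrow> real \<Rightarrow> real \<Rightarrow> real \<Rightarrow> real \<Rightarrow> real \<Rightarrow> bool" where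
  "positive_equilibrium \<alpha> c1 c2 k1 k2 p1 p2 \<longleftrightarrow>
     p1 > 0 \<and> p2 > 0 \<and> price_step \<alpha> c1 c2 k1 k2 (p1, p2) = (p1, p2)"

(* Local asymptotic stability: Lyapunov stability together with local attraction. *)
definition locally_stable :: "('a::metric_space \<Rightarrow> 'a) \<Rightarrow> 'a \<Rightarrow> bool" where
  "locally_stable f x \<longleftrightarrow> f x = x
     \<and> (\<forall>e>0. \<exists>d>0. \<forall>y. dist y x < d \<longrightarrow> (\<forall>n. dist ((f ^^ n) y) x < e))
     \<and> (\<exists>d>0. \<forall>y. dist y x < d \<longrightarrow> (\<lambda>n. (f ^^ n) y) \<longlonglongrightarrow> x)"

end

theory Submission
  imports Defs
begin

text \<open>
  For positive prices the sign of firm 1's marginal profit is that of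
  \<open>c * ((1 + \<beta>) + (p2 / p1) powr \<beta>) - \<beta> * p1\<close>. Equal costs force \<open>p1 = p2\<close>: the firm with the higher
  price has the smaller first term, hence would have to charge less. At the equilibrium the
  Jacobian of the marginal profits has a negative diagonal and is strictly diagonally dominant, so for
  small adjustment speeds the dynamics contract locally in the maximum norm.
\<close>

section \<open>Local stability of fixed points, with calculus tools\<close>

text \<open>A gauge comparable to the distance from \<open>x\<close> may shrink under
  \<open>f\<close> even where the distance itself does not. This allows contraction to be checked in
  the maximum norm although \<open>locally_stable\<close> speaks of the Euclidean metric on pairs.
  Along an orbit \<open>g\<close> decays geometrically, which gives both Lyapunov stability and
  attraction.\<close>

lemma locally_stable_gauge:
  fixes f :: "'a::metric_space \<Rightarrow> 'a" and g :: "'a \<Rightarrow> real"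
  assumes fix_x: "f x = x" and s: "0 \<le> s" "s < 1" and "\<delta> > 0" and "C > 0"
    and g_le: "\<And>y. g y \<le> dist y x" and dist_le: "\<And>y. dist y x \<le> C * g y"
    and contr: "\<And>y. dist y x < \<delta> \<Longrightarrow> g (f y) \<le> s * g y"
  shows "locally_stable f x"
proof -
  have g_nonneg: "0 \<le> g y" for y
    using order_trans[OF zero_le_dist dist_le[of y]] \<open>C > 0\<close> by (simp add: zero_le_mult_iff)
  \<comment> \<open>Starting within \<open>\<delta> / C\<close> gives
    \<open>C * g y < \<delta>\<close>. Since \<open>g\<close> does not grow, every iterate stays in
    the ball where \<open>contr\<close> applies, so the induction continues.\<close>
  have iter: "g ((f ^^ n) y) \<le> s ^ n * g y" if y: "dist y x < \<delta> / C" for y n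
  proof (induction n)
    case (Suc n)
    have "dist ((f ^^ n) y) x \<le> C * (s ^ n * g y)"
      using dist_le[of "(f ^^ n) y"] Suc \<open>C > 0\<close> by (meson mult_left_mono order_trans less_imp_le)
    also have "\<dots> \<le> C * (1 * g y)"
      using s \<open>C > 0\<close> g_nonneg by (intro mult_left_mono mult_right_mono power_le_one) auto
    also have "\<dots> < \<delta>"
      using y g_le[of y] \<open>C > 0\<close> by (simp add: field_simps) (meson le_less_trans mult_left_mono less_imp_le)
    finally have "g (f ((f ^^ n) y)) \<le> s * g ((f ^^ n) y)" by (rule contr)
    also have "\<dots> \<le> s * (s ^ n * g y)" using Suc s by (intro mult_left_mono)
    finally show ?case by (simp add: mult.assoc)
  qed simp
  have iter_dist: "dist ((f ^^ n) y) x \<le> C * (s ^ n * g y)" if "dist y x < \<delta> / C" for y n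
    using dist_le[of "(f ^^ n) y"] iter[OF that] \<open>C > 0\<close>
    by (meson mult_left_mono order_trans less_imp_le)
  show ?thesis
    unfolding locally_stable_def
  proof (intro conjI allI impI)
    show "f x = x" by fact
  next
    fix e :: real assume "e > 0"
    have "dist ((f ^^ n) y) x < e" if y: "dist y x < min (\<delta> / C) (e / C)" for y n
    proof -
      have "dist ((f ^^ n) y) x \<le> C * (s ^ n * g y)" using iter_dist y by simp
      also have "\<dots> \<le> C * (1 * g y)"
        using s \<open>C > 0\<close> g_nonneg by (intro mult_left_mono mult_right_mono power_le_one) auto
      also have "\<dots> \<le> C * dist y x" using g_le[of y] \<open>C > 0\<close> by simp
      also have "\<dots> < e" using y \<open>C > 0\<close> by (simp add: field_simps)
      finally show ?thesis .
    qed
    moreover have "min (\<delta> / C) (e / C) > 0" using \<open>\<delta> > 0\<close> \<open>e > 0\<close> \<open>C > 0\<close> by simp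
    ultimately show "\<exists>d>0. \<forall>y. dist y x < d \<longrightarrow> (\<forall>n. dist ((f ^^ n) y) x < e)" by blast
  next
    have "(\<lambda>n. (f ^^ n) y) \<longlonglongrightarrow> x" if y: "dist y x < \<delta> / C" for y
    proof (rule metric_tendsto_imp_tendsto)
      show "(\<lambda>n. C * (s ^ n * g y)) \<longlonglongrightarrow> 0"
        using s by (auto intro!: tendsto_mult_right_zero tendsto_mult_left_zero LIMSEQ_power_zero)
      show "\<forall>\<^sub>F n in sequentially. dist ((f ^^ n) y) x \<le> dist (C * (s ^ n * g y)) 0"
        using iter_dist[OF y] s \<open>C > 0\<close> g_nonneg[of y] by (simp add: abs_mult)
    qed
    moreover have "\<delta> / C > 0" using \<open>\<delta> > 0\<close> \<open>C > 0\<close> by simp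
    ultimately show "\<exists>d>0. \<forall>y. dist y x < d \<longrightarrow> (\<lambda>n. (f ^^ n) y) \<longlonglongrightarrow> x" by blast
  qed
qed

lemma norm_le_twice_max:
  fixes d :: "real \<times> real"
  shows "norm d \<le> 2 * max \<bar>fst d\<bar> \<bar>snd d\<bar>"
proof -
  have "norm d \<le> \<bar>fst d\<bar> + \<bar>snd d\<bar>"
    using sqrt_sum_squares_le_sum_abs[of "fst d" "snd d"] by (simp add: norm_prod_def)
  then show ?thesis by linarith
qed

text \<open>The absolute row sum is the norm of a linear functional with respect to the maximum
  norm; the first-order remainder adds \<open>2 * e\<close> because the Euclidean norm in the plane
  is at most twice the maximum norm.\<close>

lemma linear_remainder_bound:
  fixes a b e :: real and d :: "real \<times> real"
  assumes "\<bar>z - (a * fst d + b * snd d)\<bar> \<le> e * norm d" and "e \<ge> 0"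
  shows "\<bar>z\<bar> \<le> (\<bar>a\<bar> + \<bar>b\<bar> + 2 * e) * max \<bar>fst d\<bar> \<bar>snd d\<bar>"
proof -
  let ?m = "max \<bar>fst d\<bar> \<bar>snd d\<bar>"
  have "e * norm d \<le> e * (2 * ?m)" using norm_le_twice_max assms(2) by (rule mult_left_mono)
  moreover have "\<bar>a * fst d\<bar> \<le> \<bar>a\<bar> * ?m" "\<bar>b * snd d\<bar> \<le> \<bar>b\<bar> * ?m"
    by (auto simp: abs_mult intro!: mult_left_mono)
  ultimately show ?thesis using assms(1) by (simp add: algebra_simps abs_le_iff)
qed

text \<open>Absolute row sums below 1 make the Jacobian a strict contraction in the maximum norm,
  and near \<open>x\<close> the nonlinear remainder is too small to spoil this.\<close>

lemma locally_stable_row_sums: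
  fixes f :: "real \<times> real \<Rightarrow> real \<times> real"
  assumes fix_x: "f x = x"
    and d1: "((\<lambda>p. fst (f p)) has_derivative (\<lambda>d. a11 * fst d + a12 * snd d)) (at x)"
    and d2: "((\<lambda>p. snd (f p)) has_derivative (\<lambda>d. a21 * fst d + a22 * snd d)) (at x)"
    and r: "\<bar>a11\<bar> + \<bar>a12\<bar> < 1" "\<bar>a21\<bar> + \<bar>a22\<bar> < 1"
  shows "locally_stable f x"
proof -
  define r where "r = max (\<bar>a11\<bar> + \<bar>a12\<bar>) (\<bar>a21\<bar> + \<bar>a22\<bar>)"
  \<comment> \<open>Half of the slack \<open>1 - r\<close> is left for the remainder:
    \<open>r + 2 * e = (1 + r) / 2\<close>, which is still below 1.\<close>
  define e where "e = (1 - r) / 4"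
  define g where "g y = max \<bar>fst (y - x)\<bar> \<bar>snd (y - x)\<bar>" for y
  have "r < 1" "r \<ge> 0" using r by (auto simp: r_def le_max_iff_disj)
  then have "e > 0" by (simp add: e_def)
  have "\<bar>a11\<bar> + \<bar>a12\<bar> \<le> r" "\<bar>a21\<bar> + \<bar>a22\<bar> \<le> r" by (simp_all add: r_def)
  then have row: "\<bar>a11\<bar> + \<bar>a12\<bar> + 2 * e \<le> (1 + r) / 2" "\<bar>a21\<bar> + \<bar>a22\<bar> + 2 * e \<le> (1 + r) / 2"
    by (simp_all add: e_def field_simps)
  obtain \<delta>1 where "\<delta>1 > 0" and 1: "\<And>y. norm (y - x) < \<delta>1 \<Longrightarrow>
      \<bar>fst (f y) - fst (f x) - (a11 * fst (y - x) + a12 * snd (y - x))\<bar> \<le> e * norm (y - x)"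
    using d1 \<open>e > 0\<close> unfolding has_derivative_at_alt real_norm_def by blast
  obtain \<delta>2 where "\<delta>2 > 0" and 2: "\<And>y. norm (y - x) < \<delta>2 \<Longrightarrow>
      \<bar>snd (f y) - snd (f x) - (a21 * fst (y - x) + a22 * snd (y - x))\<bar> \<le> e * norm (y - x)"
    using d2 \<open>e > 0\<close> unfolding has_derivative_at_alt real_norm_def by blast
  show ?thesis
  proof (rule locally_stable_gauge[where g = g and C = 2 and \<delta> = "min \<delta>1 \<delta>2" and s = "(1 + r) / 2"])
    show "g y \<le> dist y x" for y
      using norm_fst_le[of "fst (y - x)" "snd (y - x)"] norm_snd_le[of "snd (y - x)" "fst (y - x)"]
      unfolding g_def dist_norm prod.collapse real_norm_def by (rule max.boundedI)
    show "dist y x \<le> 2 * g y" for y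
      unfolding g_def dist_norm by (rule norm_le_twice_max)
    fix y assume y: "dist y x < min \<delta>1 \<delta>2"
    have "\<bar>fst (f y) - fst x\<bar> \<le> (\<bar>a11\<bar> + \<bar>a12\<bar> + 2 * e) * g y"
      unfolding g_def using 1[of y] y \<open>e > 0\<close> by (intro linear_remainder_bound) (auto simp: dist_norm fix_x)
    moreover have "\<bar>snd (f y) - snd x\<bar> \<le> (\<bar>a21\<bar> + \<bar>a22\<bar> + 2 * e) * g y"
      unfolding g_def using 2[of y] y \<open>e > 0\<close> by (intro linear_remainder_bound) (auto simp: dist_norm fix_x)
    moreover have "(\<bar>a11\<bar> + \<bar>a12\<bar> + 2 * e) * g y \<le> (1 + r) / 2 * g y"
      using row(1) by (rule mult_right_mono) (simp add: g_def le_max_iff_disj)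
    moreover have "(\<bar>a21\<bar> + \<bar>a22\<bar> + 2 * e) * g y \<le> (1 + r) / 2 * g y"
      using row(2) by (rule mult_right_mono) (simp add: g_def le_max_iff_disj)
    ultimately show "g (f y) \<le> (1 + r) / 2 * g y"
      unfolding g_def[of "f y"] fst_diff snd_diff fix_x by linarith
  qed (use fix_x \<open>r < 1\<close> \<open>r \<ge> 0\<close> \<open>\<delta>1 > 0\<close> \<open>\<delta>2 > 0\<close> in auto)
qed

text \<open>At a zero of \<open>f\<close> the product-rule term containing the derivative of
  \<open>g\<close> vanishes. Hence the Jacobian at an equilibrium can be found without computing the
  derivative of the weight factor.\<close>

lemma has_derivative_mult_zero:
  fixes f g :: "'a::real_normed_vector \<Rightarrow> real"
  assumes "(f has_derivative f') (at x)" and "g differentiable (at x)" and "f x = 0"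
  shows "((\<lambda>y. f y * g y) has_derivative (\<lambda>d. f' d * g x)) (at x)"
proof -
  obtain g' where "(g has_derivative g') (at x)" using assms(2) by (auto simp: differentiable_def)
  from has_derivative_mult[OF assms(1) this] show ?thesis using assms(3) by simp
qed

section \<open>Marginal profits and the equilibrium equations\<close>

text \<open>This is the left side of the equilibrium equation of a firm charging \<open>x\<close>
  against a rival charging \<open>y\<close>, with the common factor \<open>y powr b\<close>
  cancelled. That factor and the squared denominator of the quotient rule go into the positive
  \<open>foc_weight\<close>, so \<open>foc\<close> carries the sign and the zeros of the marginal
  profit.\<close>

definition foc :: "real \<Rightarrow> real \<Rightarrow> real \<Rightarrow> real \<Rightarrow> real" where
  "foc b c x y = c * ((1 + b) * x powr b + y powr b) - b * x * x powr b"

definition foc_weight :: "real \<Rightarrow> real \<Rightarrow> real \<Rightarrow> real" where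
  "foc_weight b x y = y powr b / (x * (x powr b + y powr b))\<^sup>2"

text \<open>Relabelling the firms lets one formula for the marginal profit serve both.\<close>

lemma profit2_eq_profit1: "profit2 \<alpha> c p1 p2 = profit1 \<alpha> c p2 p1"
  by (simp add: profit1_def profit2_def demand1_def demand2_def add.commute)

lemma consumer_surplus2_eq: "consumer_surplus2 \<alpha> q1 q2 = consumer_surplus1 \<alpha> q2 q1"
  by (simp add: consumer_surplus1_def consumer_surplus2_def inverse_demand1_def
      inverse_demand2_def add.commute)

lemma foc_weight_pos: "x > 0 \<Longrightarrow> y > 0 \<Longrightarrow> foc_weight b x y > 0"
  unfolding foc_weight_def by (intro divide_pos_pos zero_less_power mult_pos_pos add_pos_pos) auto

lemma deriv_profit1:
  assumes "x > 0" "y > 0"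
  shows "deriv (\<lambda>x. profit1 \<alpha> c x y) x = foc (beta \<alpha>) c x y * foc_weight (beta \<alpha>) x y"
proof (rule DERIV_imp_deriv)
  let ?b = "beta \<alpha>"
  have nz: "x powr ?b + y powr ?b \<noteq> 0" using assms by (smt (verit) powr_gt_zero)
  \<comment> \<open>The power rule produces the exponent \<open>?b - 1\<close>; rewriting it leaves
    an identity that is rational in \<open>x\<close>, \<open>x powr ?b\<close> and
    \<open>y powr ?b\<close>.\<close>
  have ex: "x powr (?b - 1) = x powr ?b / x" using assms by (simp add: powr_diff)
  have "((\<lambda>x. (x - c) * (y powr ?b / (x * (x powr ?b + y powr ?b)))) has_real_derivative
      foc ?b c x y * foc_weight ?b x y) (at x)"
    using assms nz
    by (auto intro!: derivative_eq_intros
        simp: ex foc_def foc_weight_def divide_simps power2_eq_square)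
      (simp add: algebra_simps)
  then show "((\<lambda>x. profit1 \<alpha> c x y) has_real_derivative foc ?b c x y * foc_weight ?b x y) (at x)"
    by (simp add: profit1_def demand1_def)
qed

lemma price_step_pos:
  assumes "x > 0" "y > 0"
  shows "price_step \<alpha> c1 c2 k1 k2 (x, y) =
    (x + k1 * (foc (beta \<alpha>) c1 x y * foc_weight (beta \<alpha>) x y),
     y + k2 * (foc (beta \<alpha>) c2 y x * foc_weight (beta \<alpha>) y x))"
  using assms by (simp add: price_step_def profit2_eq_profit1 deriv_profit1)

lemma positive_equilibrium_iff_foc:
  assumes "k1 > 0" "k2 > 0"
  shows "positive_equilibrium \<alpha> c1 c2 k1 k2 x y \<longleftrightarrow>
    x > 0 \<and> y > 0 \<and> foc (beta \<alpha>) c1 x y = 0 \<and> foc (beta \<alpha>) c2 y x = 0"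
  using assms foc_weight_pos[of x y] foc_weight_pos[of y x]
  by (auto simp: positive_equilibrium_def price_step_pos) (metis less_irrefl)+

text \<open>If \<open>y < x\<close>, the first condition puts \<open>x\<close> strictly below the
  symmetric price \<open>c * (2 + b) / b\<close> and the second puts \<open>y\<close> strictly above
  it, a contradiction.\<close>

lemma foc_zero_imp_le:
  assumes "b > 0" "c > 0" "x > 0" "y > 0" "foc b c x y = 0" "foc b c y x = 0"
  shows "x \<le> y"
proof (rule ccontr)
  assume "\<not> x \<le> y"
  then have "y < x" by simp
  then have lt: "y powr b < x powr b" using assms by (intro powr_less_mono2) auto
  have "b * x * x powr b < c * (2 + b) * x powr b"
    using assms(5) mult_strict_left_mono[OF lt \<open>c > 0\<close>] by (simp add: foc_def algebra_simps)
  moreover have "b * y * y powr b > c * (2 + b) * y powr b"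
    using assms(6) mult_strict_left_mono[OF lt \<open>c > 0\<close>] by (simp add: foc_def algebra_simps)
  ultimately have "b * x < b * y" by (smt (verit) mult_less_cancel_right powr_ge_zero)
  with \<open>y < x\<close> \<open>b > 0\<close> show False by simp
qed

lemma foc_diag: "x > 0 \<Longrightarrow> foc b c x x = 0 \<longleftrightarrow> b * x = c * (2 + b)"
proof -
  assume "x > 0"
  have "foc b c x x = (c * (2 + b) - b * x) * x powr b" by (simp add: foc_def algebra_simps)
  then show ?thesis using \<open>x > 0\<close> by auto
qed

lemma beta_pos: "0 < \<alpha> \<Longrightarrow> \<alpha> < 1 \<Longrightarrow> beta \<alpha> > 0"
  by (simp add: beta_def)

lemma equilibrium_price_eq:
  assumes "0 < \<alpha>" "\<alpha> < 1"
  shows "c * (2 + beta \<alpha>) / beta \<alpha> = 2 * c / \<alpha> - c"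
  using assms by (simp add: beta_def field_simps)

text \<open>Using \<open>foc_zero_imp_le\<close> in both orders gives \<open>x = y\<close>; on the
  diagonal the remaining condition is linear in the price.\<close>

lemma positive_equilibrium_iff:
  assumes "0 < \<alpha>" "\<alpha> < 1" "c > 0" "k1 > 0" "k2 > 0"
  shows "positive_equilibrium \<alpha> c c k1 k2 x y \<longleftrightarrow> x = 2 * c / \<alpha> - c \<and> y = 2 * c / \<alpha> - c"
proof -
  note b = beta_pos[OF assms(1,2)]
  have iff: "b * x = c * (2 + b) \<longleftrightarrow> x = c * (2 + b) / b" if "b > 0" for b x :: real
    using that by (auto simp: field_simps)
  have pos: "c * (2 + beta \<alpha>) / beta \<alpha> > 0" using b \<open>c > 0\<close> by simp
  show ?thesis
    unfolding positive_equilibrium_iff_foc[OF assms(4,5)] equilibrium_price_eq[OF assms(1,2), symmetric]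
    using foc_zero_imp_le[OF b \<open>c > 0\<close>, of x y] foc_zero_imp_le[OF b \<open>c > 0\<close>, of y x]
      foc_diag[of x "beta \<alpha>" c] iff[OF b] pos by (metis antisym)
qed

section \<open>Stability of the symmetric equilibrium\<close>

text \<open>Since \<open>foc\<close> vanishes at the equilibrium, the weight enters only as a
  constant factor. The raw own-price coefficient is \<open>(1 + b) * (c * b - b * x)\<close>, up to
  the factor \<open>x powr b / x\<close>; substituting \<open>b * x = c * (2 + b)\<close> turns it
  into \<open>- (2 * c * (1 + b))\<close>.\<close>

lemma foc_has_derivative:
  assumes "x > 0" and "b * x = c * (2 + b)"
  shows "((\<lambda>p. foc b c (fst p) (snd p) * foc_weight b (fst p) (snd p)) has_derivative
    (\<lambda>d. (- (2 * c * (1 + b)) * fst d + c * b * snd d) * (x powr b / x * foc_weight b x x))) (at (x, x))"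
proof -
  have nz: "x powr b + x powr b \<noteq> 0" using assms by simp
  have "foc b c x x = 0" using assms by (simp add: foc_diag)
  moreover have "(\<lambda>p. foc_weight b (fst p) (snd p)) differentiable (at (x, x))"
    unfolding foc_weight_def differentiable_def using assms nz
    by (auto intro!: exI derivative_eq_intros)
  moreover have "((\<lambda>p. foc b c (fst p) (snd p)) has_derivative
      (\<lambda>d. (- (2 * c * (1 + b)) * fst d + c * b * snd d) * (x powr b / x))) (at (x, x))"
  proof -
    have *: "c * (2 + b) = b * x" using assms by simp
    have "(c * ((1 + b) * (b * u) + b * v) - b * (x * (b * u) + u * x) ) =
      - (2 * c * (1 + b)) * u + c * b * v" for u v
    proof -
      have "c * ((1 + b) * (b * u) + b * v) - b * (x * (b * u) + u * x) =
        c * ((1 + b) * (b * u) + b * v) - (b * x) * (1 + b) * u" by (simp add: algebra_simps)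
      then show ?thesis unfolding assms(2) by (simp add: algebra_simps)
    qed
    then have "(c * ((1 + b) * (b * u) + b * v) - b * (x * (b * u) + u * x)) * (x powr b / x) =
      (- (2 * c * (1 + b)) * u + c * b * v) * (x powr b / x)" for u v by simp
    \<comment> \<open>Reversed so that unfolding brings the claimed derivative into the unsimplified
      form that the differentiation rules deliver.\<close>
    note eq = this[symmetric]
    show ?thesis
      unfolding foc_def eq using assms
      by (auto intro!: derivative_eq_intros simp: field_simps)
  qed
  ultimately show ?thesis
    using has_derivative_mult_zero[where f = "\<lambda>p. foc b c (fst p) (snd p)"
        and g = "\<lambda>p. foc_weight b (fst p) (snd p)" and x = "(x, x)"]
    unfolding mult.assoc[symmetric] fst_conv snd_conv by blast
qed

text \<open>The bound on \<open>h\<close> keeps \<open>1 - h * A\<close> positive, so the left side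
  is \<open>1 - h * (A - B)\<close>.\<close>

lemma abs_row_sum_less_one:
  fixes A B h :: real
  assumes "0 \<le> B" "B < A" "0 < h" "h < 1 / A"
  shows "\<bar>1 - h * A\<bar> + \<bar>h * B\<bar> < 1"
proof -
  have "h * A < 1" using assms by (simp add: field_simps)
  moreover have "h * B < h * A" "0 \<le> h * B" using assms by auto
  ultimately show ?thesis by simp
qed

text \<open>The bound is \<open>K = 1 / A\<close>, with \<open>A\<close> the size of the own-price
  derivative of marginal profit; by symmetry it serves both firms. Some bound is unavoidable: for
  equal speeds \<open>h\<close> the linearization has the eigenvalue \<open>1 - h * (A + B)\<close>,
  which falls below -1 for large \<open>h\<close>.\<close>

lemma equilibrium_locally_stable:
  assumes "0 < \<alpha>" "\<alpha> < 1" "c > 0"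
  shows "\<exists>K>0. \<forall>h1 h2. 0 < h1 \<and> h1 < K \<and> 0 < h2 \<and> h2 < K \<longrightarrow>
    locally_stable (price_step \<alpha> c c h1 h2) (2 * c / \<alpha> - c, 2 * c / \<alpha> - c)"
proof -
  define b where "b = beta \<alpha>"
  define x where "x = 2 * c / \<alpha> - c"
  define M where "M = x powr b / x * foc_weight b x x"
  define A where "A = 2 * c * (1 + b) * M"
  define B where "B = c * b * M"
  have b: "b > 0" using beta_pos assms by (simp add: b_def)
  have "x = c * (2 + b) / b" using assms equilibrium_price_eq by (simp add: b_def x_def)
  then have bx: "b * x = c * (2 + b)" and x: "x > 0" using b \<open>c > 0\<close> by simp_all
  have "M > 0" unfolding M_def using x foc_weight_pos by simp
  then have AB: "0 \<le> B" "B < A" using b \<open>c > 0\<close> by (simp_all add: A_def B_def)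
  define F where "F = (\<lambda>p. foc b c (fst p) (snd p) * foc_weight b (fst p) (snd p))"
  have "(F has_derivative (\<lambda>d. (- (2 * c * (1 + b)) * fst d + c * b * snd d) * M)) (at (x, x))"
    unfolding F_def M_def by (rule foc_has_derivative[OF x bx])
  then have dF: "(F has_derivative (\<lambda>d. - A * fst d + B * snd d)) (at (x, x))"
    by (rule has_derivative_eq_rhs) (simp add: A_def B_def fun_eq_iff algebra_simps)
  have swap: "((\<lambda>p. (snd p, fst p)) has_derivative (\<lambda>d. (snd d, fst d))) (at (x, x))"
    by (auto intro!: derivative_eq_intros)
  \<comment> \<open>The second firm's marginal profit is \<open>F\<close> at the swapped pair, and
    the swap fixes \<open>(x, x)\<close>, so its derivative comes from \<open>dF\<close> by the
    chain rule.\<close>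
  have dF': "((\<lambda>p. F (snd p, fst p)) has_derivative (\<lambda>d. - A * snd d + B * fst d)) (at (x, x))"
    using has_derivative_compose[OF swap, of F "\<lambda>d. - A * fst d + B * snd d"] dF by simp
  have "locally_stable (price_step \<alpha> c c h1 h2) (x, x)"
    if h: "0 < h1" "h1 < 1 / A" "0 < h2" "h2 < 1 / A" for h1 h2
  proof (rule locally_stable_row_sums)
    \<comment> \<open>The explicit formula for \<open>price_step\<close> is available for positive
      prices; the quadrant is open, so derivatives at \<open>(x, x)\<close> carry over.\<close>
    let ?S = "{0<..} \<times> {0<..} :: (real \<times> real) set"
    have S: "open ?S" "(x, x) \<in> ?S" using x by (auto intro: open_Times)
    have step: "price_step \<alpha> c c h1 h2 p = (fst p + h1 * F p, snd p + h2 * F (snd p, fst p))"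
      if "p \<in> ?S" for p
      using that price_step_pos[of "fst p" "snd p"] by (auto simp: F_def b_def)
    show "price_step \<alpha> c c h1 h2 (x, x) = (x, x)"
      using step[OF S(2)] foc_diag[OF x] bx by (simp add: F_def)
    have "((\<lambda>p. fst p + h1 * F p) has_derivative (\<lambda>d. (1 - h1 * A) * fst d + (h1 * B) * snd d)) (at (x, x))"
      by (auto intro!: derivative_eq_intros dF simp: algebra_simps)
    then show "((\<lambda>p. fst (price_step \<alpha> c c h1 h2 p)) has_derivative
        (\<lambda>d. (1 - h1 * A) * fst d + (h1 * B) * snd d)) (at (x, x))"
      by (rule has_derivative_transform_within_open[OF _ S]) (simp add: step)
    have "((\<lambda>p. snd p + h2 * F (snd p, fst p)) has_derivative
        (\<lambda>d. (h2 * B) * fst d + (1 - h2 * A) * snd d)) (at (x, x))"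
      by (auto intro!: derivative_eq_intros dF' simp: algebra_simps)
    then show "((\<lambda>p. snd (price_step \<alpha> c c h1 h2 p)) has_derivative
        (\<lambda>d. (h2 * B) * fst d + (1 - h2 * A) * snd d)) (at (x, x))"
      by (rule has_derivative_transform_within_open[OF _ S]) (simp add: step)
    show "\<bar>1 - h1 * A\<bar> + \<bar>h1 * B\<bar> < 1" "\<bar>h2 * B\<bar> + \<bar>1 - h2 * A\<bar> < 1"
      using abs_row_sum_less_one[OF AB] h by (simp_all add: add.commute)
  qed
  moreover have "1 / A > 0" using AB by simp
  ultimately show ?thesis unfolding x_def by blast
qed

section \<open>Consumer surplus and values at equilibrium\<close>

text \<open>Up to the factor \<open>\<alpha>\<close>, the numerator of the inverse demand is the
  derivative of its denominator, so the antiderivative is a logarithm.\<close>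

lemma consumer_surplus1_eq:
  assumes "\<alpha> > 0" "q1 \<ge> 0" "q2 > 0"
  shows "consumer_surplus1 \<alpha> q1 q2 = 1 / \<alpha> * ln (1 + (q1 / q2) powr \<alpha>)"
proof -
  define F where "F x = ln (x powr \<alpha> + q2 powr \<alpha>) / \<alpha>" for x
  have pos: "x powr \<alpha> + q2 powr \<alpha> > 0" for x
    using assms by (simp add: add_nonneg_pos)
  have "((\<lambda>x. inverse_demand1 \<alpha> x q2) has_integral (F q1 - F 0)) {0..q1}"
  \<comment> \<open>The integrand blows up at 0, so the antiderivative is differentiated only in the
    open interval; at 0 its continuity is enough, which holds because
    \<open>\<alpha> > 0\<close>.\<close>
  proof (rule fundamental_theorem_of_calculus_interior[OF \<open>q1 \<ge> 0\<close>])
    show "continuous_on {0..q1} F"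
      unfolding F_def using assms pos less_imp_neq[OF pos]
      by (auto intro!: continuous_intros continuous_on_powr')
    show "(F has_vector_derivative inverse_demand1 \<alpha> x q2) (at x)" if "x \<in> {0<..<q1}" for x
      unfolding F_def has_real_derivative_iff_has_vector_derivative[symmetric]
      using that assms pos[of x]
      by (auto intro!: derivative_eq_intros simp: inverse_demand1_def)
  qed
  \<comment> \<open>As \<open>0 powr \<alpha> = 0\<close>, the lower limit contributes
    \<open>ln (q2 powr \<alpha>) / \<alpha>\<close>, which supplies the denominator inside the
    logarithm.\<close>
  moreover have "F q1 - F 0 = 1 / \<alpha> * ln (1 + (q1 / q2) powr \<alpha>)"
  proof -
    have "1 + (q1 / q2) powr \<alpha> = (q1 powr \<alpha> + q2 powr \<alpha>) / q2 powr \<alpha>"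
      using assms by (simp add: powr_divide add_divide_distrib)
    then show ?thesis using assms pos[of q1] by (simp add: F_def ln_div diff_divide_distrib)
  qed
  ultimately show ?thesis unfolding consumer_surplus1_def by (simp add: integral_unique)
qed

text \<open>The right sides are combinations of constants, \<open>1 / \<alpha>\<close> and
  \<open>1 / (\<alpha> - 2)\<close>, from which derivatives and monotonicity in
  \<open>\<alpha>\<close> can be read off.\<close>

lemma equilibrium_values:
  assumes "0 < \<alpha>" "\<alpha> < 1" "c > 0" and p: "p = 2 * c / \<alpha> - c"
  shows "demand1 \<alpha> p p = - (1 / (2 * c)) - 1 / (c * (\<alpha> - 2))"
    and "demand2 \<alpha> p p = - (1 / (2 * c)) - 1 / (c * (\<alpha> - 2))"
    and "profit1 \<alpha> c p p = 1 + 1 / (\<alpha> - 2)"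
    and "profit2 \<alpha> c p p = 1 + 1 / (\<alpha> - 2)"
    and "consumer_surplus1 \<alpha> (demand1 \<alpha> p p) (demand2 \<alpha> p p) = 1 / \<alpha> * ln 2"
    and "consumer_surplus2 \<alpha> (demand1 \<alpha> p p) (demand2 \<alpha> p p) = 1 / \<alpha> * ln 2"
    and "welfare \<alpha> c c p p = 2 / \<alpha> * ln 2 + 2 / (\<alpha> - 2) + 2"
proof -
  have p': "p = c * (2 - \<alpha>) / \<alpha>" using p \<open>0 < \<alpha>\<close> by (simp add: field_simps)
  have "p > 0" unfolding p' using assms by simp
  \<comment> \<open>At equal prices the powers cancel and each good receives half of the unit
    budget.\<close>
  then have D: "demand1 \<alpha> p p = 1 / (2 * p)" "demand2 \<alpha> p p = 1 / (2 * p)"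
    by (simp_all add: demand1_def demand2_def)
  have *: "1 / (2 * p) = - (1 / (2 * c)) - 1 / (c * (\<alpha> - 2))"
    unfolding p' using assms(1-3) by (simp add: divide_simps) (simp add: algebra_simps)
  show "demand1 \<alpha> p p = - (1 / (2 * c)) - 1 / (c * (\<alpha> - 2))"
    and "demand2 \<alpha> p p = - (1 / (2 * c)) - 1 / (c * (\<alpha> - 2))" using D * by simp_all
  have "(p - c) * (1 / (2 * p)) = 1 + 1 / (\<alpha> - 2)"
    unfolding p' using assms(1-3) by (simp add: divide_simps) (simp add: algebra_simps)
  then show P: "profit1 \<alpha> c p p = 1 + 1 / (\<alpha> - 2)" "profit2 \<alpha> c p p = 1 + 1 / (\<alpha> - 2)"
    by (simp_all add: profit1_def profit2_def D)
  show C: "consumer_surplus1 \<alpha> (demand1 \<alpha> p p) (demand2 \<alpha> p p) = 1 / \<alpha> * ln 2"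
    "consumer_surplus2 \<alpha> (demand1 \<alpha> p p) (demand2 \<alpha> p p) = 1 / \<alpha> * ln 2"
    using \<open>p > 0\<close> \<open>0 < \<alpha>\<close> by (simp_all add: D consumer_surplus2_eq consumer_surplus1_eq)
  show "welfare \<alpha> c c p p = 2 / \<alpha> * ln 2 + 2 / (\<alpha> - 2) + 2"
    unfolding welfare_def C P by simp
qed

section \<open>Comparative statics in the substitutability degree\<close>

theorem mainTheorem10:
  fixes c k1 k2 \<alpha> \<beta> :: real
  assumes "c > 0" and "k1 > 0" and "k2 > 0"
    and "0 < \<alpha>" and "\<alpha> < 1" and "\<beta> = \<alpha> / (1 - \<alpha>)"
  shows
    "(\<forall>p1 p2. positive_equilibrium \<alpha> c c k1 k2 p1 p2 \<longleftrightarrow>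
        p1 = c * (2 + \<beta>) / \<beta> \<and> p2 = c * (2 + \<beta>) / \<beta>)
   \<and> (\<forall>p1 p2 q1 q2. positive_equilibrium \<alpha> c c k1 k2 p1 p2 \<and>
        q1 = demand1 \<alpha> p1 p2 \<and> q2 = demand2 \<alpha> p1 p2 \<longrightarrow>
          q1 = \<beta> / (2 * c * (2 + \<beta>)) \<and> q2 = \<beta> / (2 * c * (2 + \<beta>))
        \<and> profit1 \<alpha> c p1 p2 = 1 / (2 + \<beta>) \<and> profit2 \<alpha> c p1 p2 = 1 / (2 + \<beta>)
        \<and> 1 / (2 + \<beta>) = 1 + 1 / (\<alpha> - 2)
        \<and> consumer_surplus1 \<alpha> q1 q2 = 1 / \<alpha> * ln 2
        \<and> consumer_surplus2 \<alpha> q1 q2 = 1 / \<alpha> * ln 2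
        \<and> welfare \<alpha> c c p1 p2 = 2 / \<alpha> * ln 2 + 2 / (\<alpha> - 2) + 2)
   \<and> (\<forall>P1 P2 Q1 Q2 \<Pi>1 \<Pi>2 W :: real \<Rightarrow> real.
        (\<forall>a. 0 < a \<and> a < 1 \<longrightarrow>
            positive_equilibrium a c c k1 k2 (P1 a) (P2 a)
          \<and> Q1 a = demand1 a (P1 a) (P2 a) \<and> Q2 a = demand2 a (P1 a) (P2 a)
          \<and> \<Pi>1 a = profit1 a c (P1 a) (P2 a) \<and> \<Pi>2 a = profit2 a c (P1 a) (P2 a)
          \<and> W a = welfare a c c (P1 a) (P2 a)) \<longrightarrow>
          (P1 has_real_derivative (- (2 * c / \<alpha>\<^sup>2))) (at \<alpha>)
        \<and> (P2 has_real_derivative (- (2 * c / \<alpha>\<^sup>2))) (at \<alpha>)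
        \<and> - (2 * c / \<alpha>\<^sup>2) < 0
        \<and> (Q1 has_real_derivative (1 / ((\<alpha> - 2)\<^sup>2 * c))) (at \<alpha>)
        \<and> (Q2 has_real_derivative (1 / ((\<alpha> - 2)\<^sup>2 * c))) (at \<alpha>)
        \<and> 1 / ((\<alpha> - 2)\<^sup>2 * c) > 0
        \<and> (\<Pi>1 has_real_derivative (- (1 / (\<alpha> - 2)\<^sup>2))) (at \<alpha>)
        \<and> (\<Pi>2 has_real_derivative (- (1 / (\<alpha> - 2)\<^sup>2))) (at \<alpha>)
        \<and> - (1 / (\<alpha> - 2)\<^sup>2) < 0
        \<and> (W has_real_derivative (- (2 * ln 2 / \<alpha>\<^sup>2) - 2 / (\<alpha> - 2)\<^sup>2)) (at \<alpha>)
        \<and> - (2 * ln 2 / \<alpha>\<^sup>2) - 2 / (\<alpha> - 2)\<^sup>2 < 0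
        \<and> (\<forall>\<alpha>'. \<alpha> < \<alpha>' \<and> \<alpha>' < 1 \<longrightarrow>
              P1 \<alpha>' < P1 \<alpha> \<and> P2 \<alpha>' < P2 \<alpha>
            \<and> Q1 \<alpha>' > Q1 \<alpha> \<and> Q2 \<alpha>' > Q2 \<alpha>
            \<and> \<Pi>1 \<alpha>' < \<Pi>1 \<alpha> \<and> \<Pi>2 \<alpha>' < \<Pi>2 \<alpha>
            \<and> W \<alpha>' < W \<alpha>
            \<and> (\<exists>K>0. \<forall>h1 h2. 0 < h1 \<and> h1 < K \<and> 0 < h2 \<and> h2 < K \<longrightarrow>
                  locally_stable (price_step \<alpha>' c c h1 h2) (P1 \<alpha>', P2 \<alpha>'))))"
proof (intro conjI)
  note ass = assms(4,5,1)
  have \<beta>: "\<beta> = beta \<alpha>" using assms by (simp add: beta_def)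
  have price: "c * (2 + \<beta>) / \<beta> = 2 * c / \<alpha> - c"
    using equilibrium_price_eq assms(4,5) by (simp add: \<beta>)
  have quantity: "\<beta> / (2 * c * (2 + \<beta>)) = - (1 / (2 * c)) - 1 / (c * (\<alpha> - 2))"
    and profit: "1 / (2 + \<beta>) = 1 + 1 / (\<alpha> - 2)"
  proof -
    have *: "2 + \<beta> = (2 - \<alpha>) / (1 - \<alpha>)" unfolding assms(6) using assms(5) by (simp add: field_simps)
    show "1 / (2 + \<beta>) = 1 + 1 / (\<alpha> - 2)"
      unfolding * using assms(4,5) by (simp add: divide_simps) (simp add: algebra_simps)
    show "\<beta> / (2 * c * (2 + \<beta>)) = - (1 / (2 * c)) - 1 / (c * (\<alpha> - 2))"
      unfolding * unfolding assms(6) using assms(1,4,5)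
      by (simp add: divide_simps) (simp add: algebra_simps)
  qed
  show "\<forall>p1 p2. positive_equilibrium \<alpha> c c k1 k2 p1 p2 \<longleftrightarrow>
      p1 = c * (2 + \<beta>) / \<beta> \<and> p2 = c * (2 + \<beta>) / \<beta>"
    unfolding price using positive_equilibrium_iff[OF ass assms(2,3)] by blast
  show "\<forall>p1 p2 q1 q2. positive_equilibrium \<alpha> c c k1 k2 p1 p2 \<and>
        q1 = demand1 \<alpha> p1 p2 \<and> q2 = demand2 \<alpha> p1 p2 \<longrightarrow>
          q1 = \<beta> / (2 * c * (2 + \<beta>)) \<and> q2 = \<beta> / (2 * c * (2 + \<beta>))
        \<and> profit1 \<alpha> c p1 p2 = 1 / (2 + \<beta>) \<and> profit2 \<alpha> c p1 p2 = 1 / (2 + \<beta>)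
        \<and> 1 / (2 + \<beta>) = 1 + 1 / (\<alpha> - 2)
        \<and> consumer_surplus1 \<alpha> q1 q2 = 1 / \<alpha> * ln 2
        \<and> consumer_surplus2 \<alpha> q1 q2 = 1 / \<alpha> * ln 2
        \<and> welfare \<alpha> c c p1 p2 = 2 / \<alpha> * ln 2 + 2 / (\<alpha> - 2) + 2"
    unfolding quantity profit positive_equilibrium_iff[OF ass assms(2,3)]
    using equilibrium_values[OF ass refl] by blast
  show "\<forall>P1 P2 Q1 Q2 \<Pi>1 \<Pi>2 W :: real \<Rightarrow> real.
        (\<forall>a. 0 < a \<and> a < 1 \<longrightarrow>
            positive_equilibrium a c c k1 k2 (P1 a) (P2 a)
          \<and> Q1 a = demand1 a (P1 a) (P2 a) \<and> Q2 a = demand2 a (P1 a) (P2 a)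
          \<and> \<Pi>1 a = profit1 a c (P1 a) (P2 a) \<and> \<Pi>2 a = profit2 a c (P1 a) (P2 a)
          \<and> W a = welfare a c c (P1 a) (P2 a)) \<longrightarrow>
          (P1 has_real_derivative (- (2 * c / \<alpha>\<^sup>2))) (at \<alpha>)
        \<and> (P2 has_real_derivative (- (2 * c / \<alpha>\<^sup>2))) (at \<alpha>)
        \<and> - (2 * c / \<alpha>\<^sup>2) < 0
        \<and> (Q1 has_real_derivative (1 / ((\<alpha> - 2)\<^sup>2 * c))) (at \<alpha>)
        \<and> (Q2 has_real_derivative (1 / ((\<alpha> - 2)\<^sup>2 * c))) (at \<alpha>)
        \<and> 1 / ((\<alpha> - 2)\<^sup>2 * c) > 0
        \<and> (\<Pi>1 has_real_derivative (- (1 / (\<alpha> - 2)\<^sup>2))) (at \<alpha>)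
        \<and> (\<Pi>2 has_real_derivative (- (1 / (\<alpha> - 2)\<^sup>2))) (at \<alpha>)
        \<and> - (1 / (\<alpha> - 2)\<^sup>2) < 0
        \<and> (W has_real_derivative (- (2 * ln 2 / \<alpha>\<^sup>2) - 2 / (\<alpha> - 2)\<^sup>2)) (at \<alpha>)
        \<and> - (2 * ln 2 / \<alpha>\<^sup>2) - 2 / (\<alpha> - 2)\<^sup>2 < 0
        \<and> (\<forall>\<alpha>'. \<alpha> < \<alpha>' \<and> \<alpha>' < 1 \<longrightarrow>
              P1 \<alpha>' < P1 \<alpha> \<and> P2 \<alpha>' < P2 \<alpha>
            \<and> Q1 \<alpha>' > Q1 \<alpha> \<and> Q2 \<alpha>' > Q2 \<alpha>
            \<and> \<Pi>1 \<alpha>' < \<Pi>1 \<alpha> \<and> \<Pi>2 \<alpha>' < \<Pi>2 \<alpha>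
            \<and> W \<alpha>' < W \<alpha>
            \<and> (\<exists>K>0. \<forall>h1 h2. 0 < h1 \<and> h1 < K \<and> 0 < h2 \<and> h2 < K \<longrightarrow>
                  locally_stable (price_step \<alpha>' c c h1 h2) (P1 \<alpha>', P2 \<alpha>')))"
  proof (intro allI impI)
    fix P1 P2 Q1 Q2 \<Pi>1 \<Pi>2 W :: "real \<Rightarrow> real"
    assume H: "\<forall>a. 0 < a \<and> a < 1 \<longrightarrow>
            positive_equilibrium a c c k1 k2 (P1 a) (P2 a)
          \<and> Q1 a = demand1 a (P1 a) (P2 a) \<and> Q2 a = demand2 a (P1 a) (P2 a)
          \<and> \<Pi>1 a = profit1 a c (P1 a) (P2 a) \<and> \<Pi>2 a = profit2 a c (P1 a) (P2 a)
          \<and> W a = welfare a c c (P1 a) (P2 a)"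
    define P where "P a = 2 * c / a - c" for a
    define Q where "Q a = - (1 / (2 * c)) - 1 / (c * (a - 2))" for a
    define R where "R a = 1 + 1 / (a - 2)" for a :: real
    define V where "V a = 2 / a * ln 2 + 2 / (a - 2) + 2" for a :: real
    \<comment> \<open>Uniqueness of the equilibrium forces any admissible choice of functions to
      agree with the closed forms on the open unit interval.\<close>
    have eq: "P1 a = P a" "P2 a = P a" "Q1 a = Q a" "Q2 a = Q a"
      "\<Pi>1 a = R a" "\<Pi>2 a = R a" "W a = V a" if "0 < a" "a < 1" for a
    proof -
      show P12: "P1 a = P a" "P2 a = P a"
        using H that positive_equilibrium_iff[OF that assms(1-3)] by (auto simp: P_def)
      show "Q1 a = Q a" "Q2 a = Q a" "\<Pi>1 a = R a" "\<Pi>2 a = R a" "W a = V a"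
        using H that equilibrium_values[OF that \<open>c > 0\<close> P_def]
        by (simp_all add: P12 Q_def R_def V_def)
    qed
    \<comment> \<open>Agreement on an open interval around \<open>\<alpha>\<close> suffices to
      transfer a derivative, whatever the functions do outside it.\<close>
    have tr: "(f has_real_derivative D) (at \<alpha>)"
      if "(g has_real_derivative D) (at \<alpha>)" "\<And>a. 0 < a \<Longrightarrow> a < 1 \<Longrightarrow> f a = g a" for f g D
      using that(1) by (rule has_field_derivative_transform_within_open[where S = "{0<..<1}"])
        (use that(2) assms(4,5) in auto)
    have dP: "(P has_real_derivative (- (2 * c / \<alpha>\<^sup>2))) (at \<alpha>)"
      unfolding P_def using assms(4,5)
      by (auto intro!: derivative_eq_intros simp: power2_eq_square)
    have dQ: "(Q has_real_derivative (1 / ((\<alpha> - 2)\<^sup>2 * c))) (at \<alpha>)"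
      unfolding Q_def using assms(1,4,5)
      by (auto intro!: derivative_eq_intros simp: power2_eq_square)
    have dR: "(R has_real_derivative (- (1 / (\<alpha> - 2)\<^sup>2))) (at \<alpha>)"
      unfolding R_def using assms(4,5)
      by (auto intro!: derivative_eq_intros simp: power2_eq_square)
    have dV: "(V has_real_derivative (- (2 * ln 2 / \<alpha>\<^sup>2) - 2 / (\<alpha> - 2)\<^sup>2)) (at \<alpha>)"
      unfolding V_def using assms(4,5)
      by (auto intro!: derivative_eq_intros simp: power2_eq_square)
    have neg: "- (2 * c / \<alpha>\<^sup>2) < 0" "1 / ((\<alpha> - 2)\<^sup>2 * c) > 0" "- (1 / (\<alpha> - 2)\<^sup>2) < 0"
      "- (2 * ln 2 / \<alpha>\<^sup>2) - 2 / (\<alpha> - 2)\<^sup>2 < 0"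
    proof -
      show "- (2 * c / \<alpha>\<^sup>2) < 0" "1 / ((\<alpha> - 2)\<^sup>2 * c) > 0" "- (1 / (\<alpha> - 2)\<^sup>2) < 0"
        using assms by simp_all
      have "2 * ln 2 / \<alpha>\<^sup>2 > 0" "2 / (\<alpha> - 2)\<^sup>2 > 0" using assms by simp_all
      then show "- (2 * ln 2 / \<alpha>\<^sup>2) - 2 / (\<alpha> - 2)\<^sup>2 < 0" by linarith
    qed
    \<comment> \<open>Monotonicity is obtained directly from the strict decrease of
      \<open>1 / a\<close> and \<open>1 / (a - 2)\<close>, without passing through the signs of the
      derivatives.\<close>
    have mono: "P a < P \<alpha>" "Q a > Q \<alpha>" "R a < R \<alpha>" "V a < V \<alpha>" if "\<alpha> < a" "a < 1" for a
    proof -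
      have i1: "1 / a < 1 / \<alpha>" using that assms(4) by (simp add: field_simps)
      have i2: "1 / (a - 2) < 1 / (\<alpha> - 2)" using that by (simp add: field_simps)
      show "P a < P \<alpha>" using mult_strict_left_mono[OF i1, of "2 * c"] \<open>c > 0\<close> by (simp add: P_def)
      show "Q a > Q \<alpha>" using mult_strict_left_mono[OF i2, of "1 / c"] \<open>c > 0\<close> by (simp add: Q_def)
      show "R a < R \<alpha>" using i2 by (simp add: R_def)
      show "V a < V \<alpha>" using mult_strict_left_mono[OF i1, of "2 * ln 2"] i2 by (simp add: V_def)
    qed
    have stable: "\<exists>K>0. \<forall>h1 h2. 0 < h1 \<and> h1 < K \<and> 0 < h2 \<and> h2 < K \<longrightarrow>
        locally_stable (price_step a c c h1 h2) (P a, P a)" if "0 < a" "a < 1" for a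
      unfolding P_def by (rule equilibrium_locally_stable[OF that \<open>c > 0\<close>])
    show "(P1 has_real_derivative (- (2 * c / \<alpha>\<^sup>2))) (at \<alpha>)
        \<and> (P2 has_real_derivative (- (2 * c / \<alpha>\<^sup>2))) (at \<alpha>)
        \<and> - (2 * c / \<alpha>\<^sup>2) < 0
        \<and> (Q1 has_real_derivative (1 / ((\<alpha> - 2)\<^sup>2 * c))) (at \<alpha>)
        \<and> (Q2 has_real_derivative (1 / ((\<alpha> - 2)\<^sup>2 * c))) (at \<alpha>)
        \<and> 1 / ((\<alpha> - 2)\<^sup>2 * c) > 0
        \<and> (\<Pi>1 has_real_derivative (- (1 / (\<alpha> - 2)\<^sup>2))) (at \<alpha>)
        \<and> (\<Pi>2 has_real_derivative (- (1 / (\<alpha> - 2)\<^sup>2))) (at \<alpha>)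
        \<and> - (1 / (\<alpha> - 2)\<^sup>2) < 0
        \<and> (W has_real_derivative (- (2 * ln 2 / \<alpha>\<^sup>2) - 2 / (\<alpha> - 2)\<^sup>2)) (at \<alpha>)
        \<and> - (2 * ln 2 / \<alpha>\<^sup>2) - 2 / (\<alpha> - 2)\<^sup>2 < 0
        \<and> (\<forall>\<alpha>'. \<alpha> < \<alpha>' \<and> \<alpha>' < 1 \<longrightarrow>
              P1 \<alpha>' < P1 \<alpha> \<and> P2 \<alpha>' < P2 \<alpha>
            \<and> Q1 \<alpha>' > Q1 \<alpha> \<and> Q2 \<alpha>' > Q2 \<alpha>
            \<and> \<Pi>1 \<alpha>' < \<Pi>1 \<alpha> \<and> \<Pi>2 \<alpha>' < \<Pi>2 \<alpha>
            \<and> W \<alpha>' < W \<alpha>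
            \<and> (\<exists>K>0. \<forall>h1 h2. 0 < h1 \<and> h1 < K \<and> 0 < h2 \<and> h2 < K \<longrightarrow>
                  locally_stable (price_step \<alpha>' c c h1 h2) (P1 \<alpha>', P2 \<alpha>')))"
      by (intro conjI neg tr[OF dP] tr[OF dQ] tr[OF dR] tr[OF dV] eq allI impI)
        (use assms(4,5) mono stable in \<open>simp_all add: eq\<close>)
  qed
qed

end
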